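(* Let $\phi=\frac{1}{2}(1+\sqrt{5})$. The Fibonacci number $F_n$ satisfies $$F_n = \operatorname{Res}_{x} \frac{(1+x)^n}{(x+\phi)(x-1/\phi)},$$ where $\operatorname{Res}_x f(x)$ denotes the sum of the residues of $f(x)$ over all its poles.
   Context: $F_n$ is the Fibonacci number, defined by the Binet formula $F_n=\frac{1}{\sqrt5}(\phi^n-(1-\phi)^n)$, where $\phi=\frac{1}{2}(1+\sqrt5)$ is the golden ratio. For a function $f(x)$ with poles $x_1,\dots,x_N$, $\operatorname{Res}_x f(x)=\sum_{p=1}^{N}\operatorname{Res}_{x=x_p} f(x)$, where the residue of $f$ at a pole $x_p$ of order $k$ is $\operatorname{Res}_{x=x_p} f(x)=\frac{1}{(k-1)!}\frac{d^{k-1}}{dx^{k-1}}\left[(x-x_p)^k f(x)\right]\Big|_{x=x_p}$. *)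

theory Defs
  imports "HOL-Complex_Analysis.Complex_Analysis" "HOL-Number_Theory.Fib"
begin

definition golden_ratio :: real where
  "golden_ratio = (1 + sqrt 5) / 2"

(* Meant for functions with finitely many poles: over an infinite set of poles the
   sum defaults to 0.  At a pole, residue agrees with the derivative formula
   (residue_pole_order). *)
definition residue_sum :: "(complex \<Rightarrow> complex) \<Rightarrow> complex" where
  "residue_sum f = (\<Sum>z | is_pole f z. residue f z)"

(* The library's recursively defined fib is the sequence given by Binet's formula. *)
lemma fib_Binet:
  "real (fib n) = 1 / sqrt 5 * (golden_ratio ^ n - (1 - golden_ratio) ^ n)"
proof -
  have "1 - golden_ratio = (1 - sqrt 5) / 2"
    by (simp add: golden_ratio_def field_simps)
  then show ?thesis
    using fib_closed_form[of n] by (simp only: golden_ratio_def[symmetric]) simp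
qed

end

theory Submission
  imports Defs
begin

text \<open>The integrand has exactly two poles, both simple:
  \<open>a = 1/\<phi> = \<phi> - 1\<close> and \<open>b = -\<phi>\<close>. With
  \<open>g x = (1 + x)^n\<close>, the residues \<open>g a / (a - b)\<close> and
  \<open>g b / (b - a)\<close> add up to the difference quotient of \<open>g\<close> between
  \<open>a\<close> and \<open>b\<close> (\<open>residue_sum_two_linear_factors\<close>). Since
  \<open>1 + a = \<phi>\<close>, \<open>1 + b = 1 - \<phi>\<close> and
  \<open>a - b = 2\<phi> - 1 = sqrt 5\<close>, this quotient is Binet's formula.\<close>

lemma pole_residue_two_linear_factors:
  assumes "g holomorphic_on UNIV" and "a \<noteq> b" and "g a \<noteq> 0"
  shows "is_pole (\<lambda>z. g z / ((z - a) * (z - b))) a"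
    and "residue (\<lambda>z. g z / ((z - a) * (z - b))) a = g a / (a - b)"
proof -
  \<comment> \<open>Near \<open>a\<close> the quotient \<open>g z / (z - b)\<close> is holomorphic,
    so only a simple factor \<open>z - a\<close> remains in the denominator.\<close>
  have eq: "(\<lambda>z. g z / ((z - a) * (z - b))) = (\<lambda>z. g z / (z - b) / (z - a))"
    by (simp add: mult.commute)
  have holo: "(\<lambda>z. g z / (z - b)) holomorphic_on - {b}"
    using assms(1) by (auto intro!: holomorphic_intros elim: holomorphic_on_subset)
  show "is_pole (\<lambda>z. g z / ((z - a) * (z - b))) a"
    using is_pole_basic[OF holo, of a 1] assms(2,3) unfolding eq
    by (simp add: open_Compl)
  show "residue (\<lambda>z. g z / ((z - a) * (z - b))) a = g a / (a - b)"
    using residue_simple[OF _ _ holo, of a] assms(2) unfolding eq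
    by (simp add: open_Compl)
qed

text \<open>Both singularities must be genuine poles, as \<open>residue_sum\<close> ranges over
  poles only; nonvanishing of \<open>g\<close> at \<open>a\<close> and \<open>b\<close> rules out
  removable ones.\<close>

lemma residue_sum_two_linear_factors:
  assumes holo: "g holomorphic_on UNIV" and "a \<noteq> b" and "g a \<noteq> 0" and "g b \<noteq> 0"
  shows "residue_sum (\<lambda>z. g z / ((z - a) * (z - b))) = (g a - g b) / (a - b)"
proof -
  let ?f = "\<lambda>z. g z / ((z - a) * (z - b))"
  note at_a = pole_residue_two_linear_factors[OF holo \<open>a \<noteq> b\<close> \<open>g a \<noteq> 0\<close>]
  \<comment> \<open>Exchanging \<open>a\<close> and \<open>b\<close> reverses the factors of the
    denominator; the unfolding restores their order.\<close>
  note at_b = pole_residue_two_linear_factors[OF holo \<open>a \<noteq> b\<close>[symmetric] \<open>g b \<noteq> 0\<close>,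
      unfolded mult.commute[of "_ - b"]]
  have "?f holomorphic_on - {a, b}"
    using holo by (auto intro!: holomorphic_intros elim: holomorphic_on_subset)
  then have "\<not> is_pole ?f z" if "z \<notin> {a, b}" for z
    using that by (intro not_is_pole_holomorphic[of "- {a, b}"]) (auto simp: open_Compl)
  then have "{z. is_pole ?f z} = {a, b}"
    using at_a(1) at_b(1) by blast
  then have "residue_sum ?f = g a / (a - b) + g b / (b - a)"
    using at_a(2) at_b(2) \<open>a \<noteq> b\<close> by (simp add: residue_sum_def)
  also have "\<dots> = (g a - g b) / (a - b)"
    using \<open>a \<noteq> b\<close> by (simp add: divide_simps) (simp add: algebra_simps)
  finally show ?thesis .
qed

theorem theorem2p1:
  fixes n :: nat
  shows "of_nat (fib n) =
    residue_sum (\<lambda>x. (1 + x) ^ n /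
      ((x + complex_of_real golden_ratio) * (x - 1 / complex_of_real golden_ratio)))"
proof -
  let ?\<phi> = "golden_ratio"
  let ?a = "complex_of_real (1 / ?\<phi>)" and ?b = "complex_of_real (- ?\<phi>)"
  have gt: "?\<phi> > 1"
    by (simp add: golden_ratio_def)
  have inv: "1 / ?\<phi> = ?\<phi> - 1"
    \<comment> \<open>Clearing the denominator leaves the quadratic equation of
      \<open>\<phi>\<close>, checked on its closed form.\<close>
    using gt by (simp add: field_simps) (simp add: golden_ratio_def field_simps)
  have diff: "?a - ?b = complex_of_real (sqrt 5)"
    unfolding inv by (simp add: golden_ratio_def field_simps)
  \<comment> \<open>By \<open>inv\<close>, \<open>1 + ?a\<close> is \<open>\<phi>\<close>, so the
    right-hand side is Binet's formula.\<close>
  have "complex_of_real (real (fib n)) = ((1 + ?a) ^ n - (1 + ?b) ^ n) / (?a - ?b)"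
    by (subst diff) (simp add: fib_Binet inv)
  also have "\<dots> = residue_sum (\<lambda>x. (1 + x) ^ n / ((x - ?a) * (x - ?b)))"
  proof (rule residue_sum_two_linear_factors[symmetric])
    show "(\<lambda>x. (1 + x) ^ n) holomorphic_on UNIV"
      by (intro holomorphic_intros)
    show "?a \<noteq> ?b"
      using diff by auto
    show "(1 + ?a) ^ n \<noteq> 0"
      using gt unfolding inv by simp
    have "1 + ?b = complex_of_real (1 - ?\<phi>)"
      by simp
    then show "(1 + ?b) ^ n \<noteq> 0"
      using gt by (metis diff_eq_eq add_0 less_irrefl of_real_eq_0_iff power_not_zero)
  qed
  also have "\<dots> = residue_sum (\<lambda>x. (1 + x) ^ n / ((x + of_real ?\<phi>) * (x - 1 / of_real ?\<phi>)))"
    by (simp add: mult.commute)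
  finally show ?thesis
    by simp
qed

end
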